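(* Let $N\ge k_p+k_q$ and consider the (two-sided) reflecting random leap on $\{0,\dots,N\}$. Then $\sum_{j=0}^N\det(\mathbf W_j)\neq 0$ and its unique stationary distribution $\boldsymbol\pi=(\pi_0,\dots,\pi_N)$ is given by \[ \pi_i=\frac{\det(\mathbf W_i)}{\sum_{j=0}^N\det(\mathbf W_j)},\qquad i\in\{0,\dots,N\}. \]
   Context: Fix an integer $k\ge1$ and nonnegative reals $p_1,\dots,p_k,q_1,\dots,q_k$ with $\sum_{j=1}^k(p_j+q_j)=1$, $\sum_{j=1}^k p_j>0$, $\sum_{j=1}^k q_j>0$, and $\gcd\{j:p_j+q_j>0\}=1$. Let $k_p=\max\{j:p_j>0\}$, $k_q=\max\{j:q_j>0\}$, $r=k_p+k_q-1$. Let $\xi$ be a random variable with $P(\xi=\ell)=p_\ell$, $P(\xi=-\ell)=q_\ell$ ($1\le\ell\le k$). The reflecting random leap on $\{0,\dots,N\}$ is the Markov chain with, for every $i\in\{0,\dots,N\}$: $P(i\to0)=P(i+\xi\le0)$, $P(i\to j)=P(i+\xi=j)$ for $1\le j\le N-1$, $P(i\to N)=P(i+\xi\ge N)$. Reverse characteristic polynomial: $\psi(z)=\sum_{j=0}^{2k-1}\gamma_jz^j$, $\gamma_j=-\sum_{\ell=k-j}^k p_\ell$ for $0\le j\le k-1$, $\gamma_j=\sum_{\ell=j-k+1}^k q_\ell$ for $k\le j\le 2k-1$. Counted with multiplicity $\psi$ has exactly $r$ nonzero roots. Let $y_1,\dots,y_s$ be its distinct nonzero roots, listed in ascending order of absolute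 value (ties broken arbitrarily), with multiplicities $r_1,\dots,r_s$. For each $j$ let $\mathbf Y^{(j)}$ be the $(N+r-1)\times r_j$ matrix with entries $Y^{(j)}_{i,\ell}=(i+1-k_p)^{\ell-1}y_j^{\,i+1-k_p}$ ($1\le i\le N+r-1$, $1\le\ell\le r_j$), with $0^0=1$, and $\mathbf Y=(\mathbf Y^{(1)}\ \cdots\ \mathbf Y^{(s)})$, an $(N+r-1)\times r$ matrix. Modified accordion matrix: for $i\in\{0,\dots,N\}$, $\mathbf A^\dagger_i$ is the $r\times(N+r-1)$ matrix $\begin{pmatrix}I_{k_p-1}&0&0&0\\0&\mathbf 1_i^T&\mathbf 0_{N-i+1}^T&0\\0&\mathbf 0_i^T&\mathbf 1_{N-i+1}^T&0\\0&0&0&I_{k_q-2}\end{pmatrix}$ if $k_q\ge2$ (column blocks of widths $k_p-1,i,N-i+1,k_q-2$), and $\begin{pmatrix}I_{k_p-1}&0&0\\0&\mathbf 1_i^T&\mathbf 0_{N-i}^T\end{pmatrix}$ if $k_q=1$. Let $\boldsymbol\eta$ be the vector of length $N+r-1$ with $\eta_j=\sum_{\ell=j-k_p+1}^{k_q}(\ell-j+k_p)q_\ell$ for $k_p\le j\le r$ and $\eta_j=0$ otherwise. For $i\in\{0,\dots,N\}$ let $\mathbf W_i$ be the $(r+1)\times(r+1)$ matrix $\mathbf W_i=\begin{pmatrix}\mathbf A_i^\dagger\mathbf Y & \mathbf e_{k_p-1}-\mathbf e_{k_p}\\ \boldsymbol\eta^T\mathbf Y & \sum_{\ell=1}^{k_p}p_\ell-\sum_{\ell=1}^{k_q}\ell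 q_\ell\end{pmatrix}$, where $\mathbf e_m$ is the $m$-th unit vector of length $r$ and $\mathbf e_{k_p-1}$ is the zero vector if $k_p=1$. *)

theory Defs
  imports "Jordan_Normal_Form.Determinant" "HOL-Computational_Algebra.Polynomial"
begin

definition xi_pmf :: "nat \<Rightarrow> (nat \<Rightarrow> real) \<Rightarrow> (nat \<Rightarrow> real) \<Rightarrow> int \<Rightarrow> real" where
  "xi_pmf k p q d =
     (if 0 < d \<and> d \<le> int k then p (nat d)
      else if d < 0 \<and> - d \<le> int k then q (nat (- d)) else 0)"

definition leap_trans :: "nat \<Rightarrow> (nat \<Rightarrow> real) \<Rightarrow> (nat \<Rightarrow> real) \<Rightarrow> nat \<Rightarrow> nat \<Rightarrow> nat \<Rightarrow> real" where
  "leap_trans k p q N i j =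
     (if j = 0 then (\<Sum>d\<in>{- int k..int k}. if int i + d \<le> 0 then xi_pmf k p q d else 0)
      else if j = N then (\<Sum>d\<in>{- int k..int k}. if int i + d \<ge> int N then xi_pmf k p q d else 0)
      else (\<Sum>d\<in>{- int k..int k}. if int i + d = int j then xi_pmf k p q d else 0))"

definition is_stationary :: "nat \<Rightarrow> (nat \<Rightarrow> real) \<Rightarrow> (nat \<Rightarrow> real) \<Rightarrow> nat \<Rightarrow> (nat \<Rightarrow> real) \<Rightarrow> bool" where
  "is_stationary k p q N \<pi> \<longleftrightarrow>
     (\<forall>i\<le>N. 0 \<le> \<pi> i) \<and> (\<Sum>i\<le>N. \<pi> i) = 1 \<and>
     (\<forall>j\<le>N. (\<Sum>i\<le>N. \<pi> i * leap_trans k p q N i j) = \<pi> j)"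

definition kp :: "nat \<Rightarrow> (nat \<Rightarrow> real) \<Rightarrow> nat" where
  "kp k p = Max {j\<in>{1..k}. p j > 0}"

definition kq :: "nat \<Rightarrow> (nat \<Rightarrow> real) \<Rightarrow> nat" where
  "kq k q = Max {j\<in>{1..k}. q j > 0}"

definition rr :: "nat \<Rightarrow> (nat \<Rightarrow> real) \<Rightarrow> (nat \<Rightarrow> real) \<Rightarrow> nat" where
  "rr k p q = kp k p + kq k q - 1"

definition gamma :: "nat \<Rightarrow> (nat \<Rightarrow> real) \<Rightarrow> (nat \<Rightarrow> real) \<Rightarrow> nat \<Rightarrow> real" where
  "gamma k p q j =
     (if j \<le> k - 1 then - (\<Sum>l = k - j..k. p l)
      else if k \<le> j \<and> j \<le> 2 * k - 1 then (\<Sum>l = j - k + 1..k. q l) else 0)"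

definition psi :: "nat \<Rightarrow> (nat \<Rightarrow> real) \<Rightarrow> (nat \<Rightarrow> real) \<Rightarrow> complex poly" where
  "psi k p q = (\<Sum>j\<le>2 * k - 1. monom (complex_of_real (gamma k p q j)) j)"

text \<open>Columns of Y: for each distinct nonzero root y (in the given order) the pairs
  (y, l) with 1 <= l <= multiplicity of y.\<close>
definition Y_cols :: "complex poly \<Rightarrow> complex list \<Rightarrow> (complex \<times> nat) list" where
  "Y_cols P ys = concat (map (\<lambda>y. map (\<lambda>l. (y, l)) [1..<order y P + 1]) ys)"

text \<open>Matrix Y, (N+r-1) x r; JNF indices are 0-based, so row i0 is row i0+1 of the paper.\<close>
definition Ymat :: "nat \<Rightarrow> (nat \<Rightarrow> real) \<Rightarrow> (nat \<Rightarrow> real) \<Rightarrow> nat \<Rightarrow> complex list \<Rightarrow> complex mat" where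
  "Ymat k p q N ys =
     mat (N + rr k p q - 1) (rr k p q)
       (\<lambda>(i0, c0). let (y, l) = Y_cols (psi k p q) ys ! c0;
                       e = int (i0 + 1) + 1 - int (kp k p) in
                   (of_int e) ^ (l - 1) * y powi e)"

text \<open>Modified accordion matrix A_i^dagger, r x (N+r-1) (1-based entry description a, b).\<close>
definition Adag_entry :: "nat \<Rightarrow> nat \<Rightarrow> nat \<Rightarrow> nat \<Rightarrow> nat \<Rightarrow> nat \<Rightarrow> complex" where
  "Adag_entry kP kQ N i a b =
     (if a \<le> kP - 1 then (if b = a then 1 else 0)
      else if a = kP then (if kP \<le> b \<and> b \<le> kP - 1 + i then 1 else 0)
      else if a = kP + 1 \<and> kQ \<ge> 2 then (if kP + i \<le> b \<and> b \<le> kP + N then 1 else 0)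
      else (if b = a + N - 1 then 1 else 0))"

definition Adag :: "nat \<Rightarrow> (nat \<Rightarrow> real) \<Rightarrow> (nat \<Rightarrow> real) \<Rightarrow> nat \<Rightarrow> nat \<Rightarrow> complex mat" where
  "Adag k p q N i =
     mat (rr k p q) (N + rr k p q - 1)
       (\<lambda>(a0, b0). Adag_entry (kp k p) (kq k q) N i (a0 + 1) (b0 + 1))"

text \<open>The vector eta (1-based entry j), of length N+r-1.\<close>
definition eta_entry :: "nat \<Rightarrow> (nat \<Rightarrow> real) \<Rightarrow> (nat \<Rightarrow> real) \<Rightarrow> nat \<Rightarrow> real" where
  "eta_entry k p q j =
     (if kp k p \<le> j \<and> j \<le> rr k p q
      then (\<Sum>l = j - kp k p + 1..kq k q. (real l - real j + real (kp k p)) * q l) else 0)"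

definition eta_row :: "nat \<Rightarrow> (nat \<Rightarrow> real) \<Rightarrow> (nat \<Rightarrow> real) \<Rightarrow> nat \<Rightarrow> complex mat" where
  "eta_row k p q N = mat 1 (N + rr k p q - 1) (\<lambda>(_, j0). complex_of_real (eta_entry k p q (j0 + 1)))"

text \<open>The column e_{kp-1} - e_{kp} of length r (e_0 = 0 when kp = 1).\<close>
definition e_col :: "nat \<Rightarrow> (nat \<Rightarrow> real) \<Rightarrow> (nat \<Rightarrow> real) \<Rightarrow> complex mat" where
  "e_col k p q = mat (rr k p q) 1
     (\<lambda>(m0, _). (if m0 + 1 = kp k p - 1 \<and> kp k p \<ge> 2 then 1 else 0)
               - (if m0 + 1 = kp k p then 1 else 0))"

definition Wmat :: "nat \<Rightarrow> (nat \<Rightarrow> real) \<Rightarrow> (nat \<Rightarrow> real) \<Rightarrow> nat \<Rightarrow> complex list \<Rightarrow> nat \<Rightarrow> complex mat" where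
  "Wmat k p q N ys i =
     four_block_mat
       (Adag k p q N i * Ymat k p q N ys) (e_col k p q)
       (eta_row k p q N * Ymat k p q N ys)
       (mat 1 1 (\<lambda>_. complex_of_real
          ((\<Sum>l = 1..kp k p. p l) - (\<Sum>l = 1..kq k q. real l * q l))))"

end

theory Submission
  imports Defs "HOL-Computational_Algebra.Fundamental_Theorem_Algebra"
begin

text \<open>
  Extend a vector \<open>u\<close> on \<open>{0..N}\<close> by zero. It is invariant iff the net flow across every cut
  \<open>{0..<j} | {j..N}\<close> vanishes, and the flow is the linear recurrence with characteristic polynomial
  \<open>psi\<close>. Hence the differences \<open>X e = u e - u (e - 1)\<close> satisfy this recurrence, so that
  \<open>X = Y c\<close> for some \<open>c\<close>. With \<open>t = - u 0\<close>, the rows of \<open>W\<^sub>i (c, t)\<close> express the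
  vanishing of \<open>X\<close> outside \<open>{0..N + 1}\<close>, the flow across the first cut (last row), and
  \<open>u i = X 1 + \<dots> + X i - t\<close> (row \<open>k\<^sub>p\<close>). Up to a row operation only row \<open>k\<^sub>p\<close>
  depends on \<open>i\<close>; if \<open>(c, t)\<close> is the vector of its cofactors, all other rows vanish
  and row \<open>k\<^sub>p\<close> gives \<open>u i = det W\<^sub>i\<close>. So \<open>det W\<^sub>i\<close> is invariant and, by uniqueness,
  a multiple of the stationary distribution. The multiple is nonzero: if \<open>\<pi>\<^sub>i > 0\<close>, a kernel vector of
  \<open>W\<^sub>i\<close> yields an invariant vector vanishing at \<open>i\<close>, hence zero, and \<open>c \<mapsto> Y c\<close> is injective
  (confluent Vandermonde).
\<close>

section \<open>Root multiplicities and moments of the coefficients\<close>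

text \<open>The operator \<open>n + x d/dx\<close>: its iterates multiply coefficient
  \<open>j\<close> by powers of \<open>n + j\<close>, the polynomial factors in the columns of
  Y.\<close>

definition euler_op :: "'a \<Rightarrow> 'a poly \<Rightarrow> 'a::{comm_semiring_1,semiring_no_zero_divisors} poly" where
  "euler_op n f = smult n f + pCons 0 (pderiv f)"

lemma coeff_euler_op: "coeff (euler_op n f) j = (n + of_nat j) * coeff f j"
  unfolding euler_op_def by (cases j) (auto simp: coeff_pderiv coeff_pCons algebra_simps)

lemma degree_euler_op_le: "degree (euler_op n f) \<le> degree f"
  by (rule degree_le) (auto simp: coeff_euler_op coeff_eq_0)

lemma poly_eq_sum_coeff:
  fixes f :: "'a::comm_semiring_1 poly"
  assumes "degree f \<le> d"
  shows "poly f y = (\<Sum>j\<le>d. coeff f j * y ^ j)"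
proof -
  have "(\<Sum>j\<le>d. coeff f j * y ^ j) = (\<Sum>j\<le>degree f. coeff f j * y ^ j)"
    by (rule sum.mono_neutral_right) (use assms in \<open>auto simp: coeff_eq_0\<close>)
  then show ?thesis by (simp add: poly_altdef)
qed

text \<open>If \<open>f\<close> has a root of order s + 1 at \<open>y\<close>, then
  \<open>x f'\<close> has order exactly s there, because \<open>y\<close> is nonzero and the
  characteristic is 0, while \<open>n f\<close> has order at least s + 1. So the operator lowers the
  order by exactly one.\<close>

lemma linear_power_Suc_dvd_iff_euler_op:
  fixes f :: "'a::field_char_0 poly"
  assumes y: "y \<noteq> 0"
  shows "[:-y, 1:] ^ Suc R dvd f \<longleftrightarrow> poly f y = 0 \<and> [:-y, 1:] ^ R dvd euler_op n f"
proof (cases "f = 0 \<or> poly f y \<noteq> 0")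
  case True
  then show ?thesis
  proof
    assume "f = 0"
    then show ?thesis by (simp add: euler_op_def)
  next
    assume "poly f y \<noteq> 0"
    moreover have "poly f y = 0" if "[:-y, 1:] ^ Suc R dvd f"
      using that by (metis dvd_mult_left poly_eq_0_iff_dvd power_Suc)
    ultimately show ?thesis by blast
  qed
next
  case False
  then have f: "f \<noteq> 0" "poly f y = 0" by auto
  define s where "s = order y (pderiv f)"
  have ord: "order y f = Suc s" using order_pderiv[OF f] by (simp add: s_def)
  have pd: "pderiv f \<noteq> 0"
  proof
    assume "pderiv f = 0"
    then have "degree f = 0" by (simp add: pderiv_eq_0_iff)
    then obtain c where "f = [:c:]" by (rule degree_eq_zeroE)
    then show False using f by simp
  qed
  have "[:-y, 1:] ^ R dvd euler_op n f \<longleftrightarrow> R \<le> s"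
  proof
    assume R: "R \<le> s"
    then have "[:-y, 1:] ^ R dvd pderiv f" "[:-y, 1:] ^ R dvd f"
      using pd f ord by (auto simp: order_divides s_def)
    then have "[:-y, 1:] ^ R dvd smult n f + [:0,1:] * pderiv f"
      by (intro dvd_add dvd_smult dvd_mult)
    then show "[:-y, 1:] ^ R dvd euler_op n f" by (simp add: euler_op_def)
  next
    assume d: "[:-y, 1:] ^ R dvd euler_op n f"
    show "R \<le> s"
    proof (rule ccontr)
      assume "\<not> R \<le> s"
      then have "[:-y, 1:] ^ Suc s dvd euler_op n f"
        using d by (meson dvd_trans le_imp_power_dvd not_less_eq_eq)
      moreover have "[:-y, 1:] ^ Suc s dvd smult n f"
        using ord f by (intro dvd_smult) (simp add: order_divides del: power_Suc)
      ultimately have "[:-y, 1:] ^ Suc s dvd [:0,1:] * pderiv f"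
        unfolding euler_op_def by (simp add: dvd_add_right_iff del: power_Suc)
      moreover have ne: "[:0,1:] * pderiv f \<noteq> 0" using pd by simp
      ultimately have "Suc s \<le> order y ([:0,1:] * pderiv f)" by (simp add: order_divides del: power_Suc)
      also have "\<dots> = order y [:0,1:] + s" using order_mult[OF ne] by (simp add: s_def)
      also have "order y [:0,1:] = 0" using y by (intro order_0I) auto
      finally show False by simp
    qed
  qed
  then show ?thesis using f ord by (simp add: order_divides del: power_Suc)
qed

text \<open>Iterates the previous equivalence. From left to right it makes the columns of Y solve
  the recurrence; from right to left it counts roots in the confluent Vandermonde argument. The
  shift \<open>n\<close> allows windows starting at any integer.\<close>

lemma linear_power_dvd_iff_moments:
  fixes f :: "'a::field_char_0 poly"
  assumes y: "y \<noteq> 0" and d: "degree f \<le> d"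
  shows "[:-y, 1:] ^ R dvd f \<longleftrightarrow> (\<forall>m<R. (\<Sum>j\<le>d. coeff f j * (n + of_nat j) ^ m * y ^ j) = 0)"
  using d
proof (induction R arbitrary: f)
  case 0
  then show ?case by simp
next
  case (Suc R)
  let ?S = "\<lambda>m f. \<Sum>j\<le>d. coeff f j * (n + of_nat j) ^ m * y ^ j"
  have S: "?S (Suc m) f = ?S m (euler_op n f)" for m
    by (simp add: coeff_euler_op algebra_simps)
  have "[:-y, 1:] ^ Suc R dvd f \<longleftrightarrow> poly f y = 0 \<and> [:-y, 1:] ^ R dvd euler_op n f"
    by (rule linear_power_Suc_dvd_iff_euler_op[OF y])
  also have "\<dots> \<longleftrightarrow> ?S 0 f = 0 \<and> (\<forall>m<R. ?S m (euler_op n f) = 0)"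
    using Suc.IH[of "euler_op n f"] Suc.prems degree_euler_op_le[of n f]
    by (simp add: poly_eq_sum_coeff[OF Suc.prems])
  also have "\<dots> \<longleftrightarrow> ?S 0 f = 0 \<and> (\<forall>m<R. ?S (Suc m) f = 0)" by (simp only: S)
  also have "\<dots> \<longleftrightarrow> (\<forall>m<Suc R. ?S m f = 0)"
    by (auto simp only: less_Suc_eq_0_disj)
  finally show ?case .
qed

lemma sum_order_le_degree:
  fixes f :: "'a::idom poly"
  assumes "f \<noteq> 0" "finite A"
  shows "(\<Sum>y\<in>A. order y f) \<le> degree f"
proof -
  have "(\<Sum>y\<in>A. order y f) = (\<Sum>y\<in>A. count (proots f) y)" using assms by simp
  also have "\<dots> \<le> (\<Sum>y\<in>A \<union> set_mset (proots f). count (proots f) y)"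
    using assms poly_roots_finite[OF assms(1)] by (intro sum_mono2) auto
  also have "\<dots> = size (proots f)"
    unfolding size_multiset_overloaded_eq using assms
    by (intro sum.mono_neutral_right) (auto simp: count_eq_zero_iff simp del: count_proots set_count_proots)
  also have "\<dots> \<le> degree f" by (rule size_proots_le)
  finally show ?thesis .
qed

text \<open>Over the complex numbers multiplicities exhaust the degree; the root 0 is split off
  since only nonzero roots give columns of Y.\<close>

lemma sum_order_nonzero_roots_complex:
  fixes f :: "complex poly"
  assumes f: "f \<noteq> 0"
  shows "(\<Sum>y\<in>{y. y \<noteq> 0 \<and> poly f y = 0}. order y f) + order 0 f = degree f"
proof -
  let ?A = "{y. y \<noteq> 0 \<and> poly f y = 0}"
  have fin: "finite ?A" using poly_roots_finite[OF f] by (auto intro: finite_subset[rotated])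
  have "degree f = size (proots f)" by (simp add: size_proots_complex)
  also have "\<dots> = (\<Sum>y\<in>set_mset (proots f). order y f)"
    unfolding size_multiset_overloaded_eq using f by simp
  also have "\<dots> = (\<Sum>y\<in>insert 0 ?A. order y f)"
    using f fin by (intro sum.mono_neutral_left) (auto simp: order_root)
  also have "\<dots> = (\<Sum>y\<in>?A. order y f) + order 0 f" using fin by simp
  finally show ?thesis by simp
qed

section \<open>Invariant vectors of a finite chain\<close>

text \<open>By \<open>upward\<close>, state \<open>N\<close> is reachable from every state; this is
  the form of irreducibility from which uniqueness is derived.\<close>

locale stochastic_upward =
  fixes N :: nat and P :: "nat \<Rightarrow> nat \<Rightarrow> real"
  assumes nonneg: "\<And>i j. i \<le> N \<Longrightarrow> j \<le> N \<Longrightarrow> 0 \<le> P i j"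
    and row_sum: "\<And>i. i \<le> N \<Longrightarrow> (\<Sum>j\<le>N. P i j) = 1"
    and upward: "\<And>i. i < N \<Longrightarrow> \<exists>j. i < j \<and> j \<le> N \<and> P i j > 0"
begin

definition invariant :: "(nat \<Rightarrow> real) \<Rightarrow> bool" where
  "invariant \<mu> \<longleftrightarrow> (\<forall>j\<le>N. (\<Sum>i\<le>N. \<mu> i * P i j) = \<mu> j)"

lemma invariant_top_pos:
  assumes inv: "invariant \<mu>" and nn: "\<And>i. i \<le> N \<Longrightarrow> 0 \<le> \<mu> i"
  shows "i \<le> N \<Longrightarrow> 0 < \<mu> i \<Longrightarrow> 0 < \<mu> N"
proof (induction "N - i" arbitrary: i rule: less_induct)
  case less
  show ?case
  proof (cases "i = N")
    case True
    then show ?thesis using less by simp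
  next
    case False
    then obtain j where j: "i < j" "j \<le> N" "P i j > 0" using upward[of i] less.prems by auto
    have "0 < \<mu> i * P i j" using j less.prems by simp
    also have "\<dots> \<le> (\<Sum>i\<le>N. \<mu> i * P i j)"
      using less.prems j nn nonneg by (intro member_le_sum) auto
    also have "\<dots> = \<mu> j" using inv j by (simp add: invariant_def)
    finally show ?thesis using less.hyps[of j] j less.prems by auto
  qed
qed

text \<open>The triangle inequality gives \<open>|\<mu>| \<le> |\<mu>| P\<close> in each coordinate;
  both sides have the same total because rows sum to 1, so equality holds.\<close>

lemma invariant_abs:
  assumes inv: "invariant \<mu>"
  shows "invariant (\<lambda>i. \<bar>\<mu> i\<bar>)"
proof -
  let ?d = "\<lambda>j. (\<Sum>i\<le>N. \<bar>\<mu> i\<bar> * P i j) - \<bar>\<mu> j\<bar>"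
  have nn: "0 \<le> ?d j" if "j \<in> {..N}" for j
  proof -
    have "\<bar>\<mu> j\<bar> = \<bar>\<Sum>i\<le>N. \<mu> i * P i j\<bar>" using inv that by (simp add: invariant_def)
    also have "\<dots> \<le> (\<Sum>i\<le>N. \<bar>\<mu> i * P i j\<bar>)" by (rule sum_abs)
    also have "\<dots> = (\<Sum>i\<le>N. \<bar>\<mu> i\<bar> * P i j)"
      using nonneg that by (intro sum.cong) (auto simp: abs_mult)
    finally show ?thesis by simp
  qed
  have "(\<Sum>j\<le>N. \<Sum>i\<le>N. \<bar>\<mu> i\<bar> * P i j) = (\<Sum>i\<le>N. \<bar>\<mu> i\<bar> * (\<Sum>j\<le>N. P i j))"
    unfolding sum_distrib_left by (rule sum.swap)
  also have "\<dots> = (\<Sum>i\<le>N. \<bar>\<mu> i\<bar>)" using row_sum by simp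
  finally have "(\<Sum>j\<le>N. ?d j) = 0" by (simp add: sum_subtractf)
  then have "\<forall>j\<in>{..N}. ?d j = 0" using nn sum_nonneg_eq_0_iff[of "{..N}" ?d] by blast
  then show ?thesis by (auto simp: invariant_def)
qed

text \<open>The vectors \<open>|\<mu>| + \<mu>\<close> and \<open>|\<mu>| - \<mu>\<close> are
  invariant and nonnegative, and they cannot both be positive at \<open>N\<close>. So one of them
  vanishes, \<mu> has constant sign, and sum zero forces it to vanish.\<close>

lemma invariant_sum_zero:
  assumes inv: "invariant \<mu>" and s: "(\<Sum>i\<le>N. \<mu> i) = 0" and i: "i \<le> N"
  shows "\<mu> i = 0"
proof -
  define a where "a = (\<lambda>i. \<bar>\<mu> i\<bar> + \<mu> i)"
  define b where "b = (\<lambda>i. \<bar>\<mu> i\<bar> - \<mu> i)"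
  have "invariant a" "invariant b"
    using inv invariant_abs[OF inv]
    by (auto simp: invariant_def a_def b_def ring_distribs sum.distrib sum_subtractf)
  moreover have nn: "0 \<le> a i" "0 \<le> b i" for i by (auto simp: a_def b_def)
  ultimately have top: "\<And>i. i \<le> N \<Longrightarrow> 0 < a i \<Longrightarrow> 0 < a N" "\<And>i. i \<le> N \<Longrightarrow> 0 < b i \<Longrightarrow> 0 < b N"
    using invariant_top_pos by blast+
  have "\<not> (0 < a N \<and> 0 < b N)" by (auto simp: a_def b_def)
  then consider "\<forall>i\<le>N. a i = 0" | "\<forall>i\<le>N. b i = 0"
    using top nn by (metis order_less_le)
  then show ?thesis
  proof cases
    case 1
    then have eq: "\<And>i. i \<le> N \<Longrightarrow> \<bar>\<mu> i\<bar> = - \<mu> i" by (auto simp: a_def eq_neg_iff_add_eq_0)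
    then have "(\<Sum>i\<le>N. \<bar>\<mu> i\<bar>) = (\<Sum>i\<le>N. - \<mu> i)" by (intro sum.cong) auto
    also have "\<dots> = 0" using s by (simp add: sum_negf)
    finally show ?thesis using i by (simp add: sum_nonneg_eq_0_iff)
  next
    case 2
    then have eq: "\<And>i. i \<le> N \<Longrightarrow> \<mu> i = \<bar>\<mu> i\<bar>" by (simp add: b_def)
    then have "(\<Sum>i\<le>N. \<bar>\<mu> i\<bar>) = (\<Sum>i\<le>N. \<mu> i)" by (intro sum.cong) auto
    then show ?thesis using i s by (simp add: sum_nonneg_eq_0_iff)
  qed
qed

text \<open>Row sums 1 make the all-ones vector a right null vector of \<open>P - I\<close>; the
  transpose is then singular too, which yields a left null vector.\<close>

lemma invariant_nonzero_exists: "\<exists>\<mu>. invariant \<mu> \<and> (\<exists>i\<le>N. \<mu> i \<noteq> 0)"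
proof -
  let ?n = "Suc N"
  define A where "A = mat ?n ?n (\<lambda>(i, j). P i j - (if i = j then 1 else 0))"
  have A: "A \<in> carrier_mat ?n ?n" by (simp add: A_def)
  define u where "u = vec ?n (\<lambda>_. 1::real)"
  have "A *\<^sub>v u = 0\<^sub>v ?n"
  proof (rule eq_vecI)
    fix i assume "i < dim_vec (0\<^sub>v ?n :: real vec)"
    then have i: "i \<le> N" by simp
    have "(A *\<^sub>v u) $ i = (\<Sum>j = 0..<?n. P i j - (if i = j then 1 else 0))"
      using i by (simp add: A_def u_def scalar_prod_def)
    also have "\<dots> = (\<Sum>j\<le>N. P i j) - (\<Sum>j\<le>N. if i = j then 1 else 0)"
      by (simp add: sum_subtractf atLeast0LessThan lessThan_Suc_atMost)
    also have "\<dots> = 0" using i row_sum by simp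
    finally show "(A *\<^sub>v u) $ i = 0\<^sub>v ?n $ i" using i by simp
  qed (simp add: A_def)
  moreover have "u \<in> carrier_vec ?n" by (simp add: u_def)
  moreover have "u \<noteq> 0\<^sub>v ?n"
  proof
    assume "u = 0\<^sub>v ?n"
    then have "u $ 0 = 0\<^sub>v ?n $ 0" by simp
    then show False by (simp add: u_def)
  qed
  ultimately have "det A = 0" using det_0_iff_vec_prod_zero[OF A] by blast
  then have "det A\<^sup>T = 0" using det_transpose[OF A] by simp
  then obtain v where v: "v \<in> carrier_vec ?n" "v \<noteq> 0\<^sub>v ?n" "A\<^sup>T *\<^sub>v v = 0\<^sub>v ?n"
    using det_0_iff_vec_prod_zero[of "A\<^sup>T" ?n] A by auto
  have "invariant (\<lambda>i. v $ i)" unfolding invariant_def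
  proof (intro allI impI)
    fix j assume j: "j \<le> N"
    have "0 = (A\<^sup>T *\<^sub>v v) $ j" using v j by simp
    also have "\<dots> = (\<Sum>i = 0..<?n. (P i j - (if i = j then 1 else 0)) * v $ i)"
      using j v(1) by (simp add: A_def scalar_prod_def)
    also have "\<dots> = (\<Sum>i\<le>N. v $ i * P i j) - (\<Sum>i\<le>N. if i = j then v $ i else 0)"
      unfolding sum_subtractf[symmetric] atLeast0LessThan lessThan_Suc_atMost
      by (intro sum.cong) (auto simp: algebra_simps)
    also have "(\<Sum>i\<le>N. if i = j then v $ i else 0) = v $ j" using j by simp
    finally show "(\<Sum>i\<le>N. v $ i * P i j) = v $ j" by simp
  qed
  moreover have "\<exists>i\<le>N. v $ i \<noteq> 0"
  proof (rule ccontr)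
    assume "\<not> ?thesis"
    then have "v = 0\<^sub>v ?n" using v(1) by (intro eq_vecI) auto
    then show False using v by simp
  qed
  ultimately show ?thesis by blast
qed

lemma invariant_unique:
  assumes "invariant \<mu>" "invariant \<nu>" "(\<Sum>i\<le>N. \<nu> i) = 1" "i \<le> N"
  shows "\<mu> i = (\<Sum>i\<le>N. \<mu> i) * \<nu> i"
proof -
  define s where "s = (\<Sum>i\<le>N. \<mu> i)"
  have "invariant (\<lambda>i. \<mu> i - s * \<nu> i)"
    using assms by (simp add: invariant_def left_diff_distrib sum_subtractf mult.assoc sum_distrib_left[symmetric])
  moreover have "(\<Sum>i\<le>N. \<mu> i - s * \<nu> i) = 0"
    using assms by (simp add: sum_subtractf sum_distrib_left[symmetric] s_def)
  ultimately show ?thesis using invariant_sum_zero assms(4) by (fastforce simp: s_def)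
qed

text \<open>Real and imaginary parts are treated separately. Complex vectors arise because Y is
  built from complex roots.\<close>

lemma invariant_complex_unique:
  fixes \<mu> :: "nat \<Rightarrow> complex"
  assumes inv: "\<And>j. j \<le> N \<Longrightarrow> (\<Sum>i\<le>N. \<mu> i * of_real (P i j)) = \<mu> j"
    and \<nu>: "invariant \<nu>" "(\<Sum>i\<le>N. \<nu> i) = 1" and i: "i \<le> N"
  shows "\<mu> i = (\<Sum>i\<le>N. \<mu> i) * of_real (\<nu> i)"
proof -
  have "invariant (\<lambda>i. Re (\<mu> i))" "invariant (\<lambda>i. Im (\<mu> i))"
    unfolding invariant_def using inv[THEN arg_cong[where f = Re]] inv[THEN arg_cong[where f = Im]]
    by auto
  then show ?thesis
    using invariant_unique[OF _ \<nu> i] by (auto simp: complex_eq_iff)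
qed

lemma stationary_exists:
  "\<exists>\<nu>. (\<forall>i\<le>N. 0 \<le> \<nu> i) \<and> (\<Sum>i\<le>N. \<nu> i) = 1 \<and> invariant \<nu>"
proof -
  obtain \<mu> i where \<mu>: "invariant \<mu>" "i \<le> N" "\<mu> i \<noteq> 0" using invariant_nonzero_exists by blast
  define s where "s = (\<Sum>i\<le>N. \<bar>\<mu> i\<bar>)"
  have "0 < \<bar>\<mu> i\<bar>" using \<mu> by simp
  also have "\<dots> \<le> s" unfolding s_def using \<mu>(2) by (intro member_le_sum) auto
  finally have s: "s > 0" .
  have "invariant (\<lambda>i. \<bar>\<mu> i\<bar> / s)"
    using invariant_abs[OF \<mu>(1)] by (simp add: invariant_def sum_divide_distrib[symmetric])
  moreover have "(\<Sum>i\<le>N. \<bar>\<mu> i\<bar> / s) = 1"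
    using s by (simp add: sum_divide_distrib[symmetric] s_def)
  ultimately show ?thesis using s by (intro exI[of _ "\<lambda>i. \<bar>\<mu> i\<bar> / s"]) auto
qed

end

section \<open>Cut equations\<close>

lemma sum_by_parts_complex:
  fixes u :: "int \<Rightarrow> complex"
  shows "(\<Sum>e = 1..n. h e * (u (int e) - u (int e - 1)))
    = (\<Sum>e = 1..n. (h e - h (Suc e)) * u (int e)) - h 1 * u 0 + h (Suc n) * u (int n)"
  by (induction n) (auto simp: algebra_simps)

lemma Max_support:
  fixes f :: "nat \<Rightarrow> real" and k :: nat
  assumes "\<forall>j\<in>{1..k}. f j \<ge> 0" "(\<Sum>j = 1..k. f j) > 0"
  defines "M \<equiv> Max {j\<in>{1..k}. f j > 0}"
  shows "1 \<le> M" "M \<le> k" "f M > 0" "\<And>j. M < j \<Longrightarrow> j \<le> k \<Longrightarrow> f j = 0"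
proof -
  let ?A = "{j\<in>{1..k}. f j > 0}"
  have "?A \<noteq> {}"
  proof
    assume "?A = {}"
    then have "(\<Sum>j = 1..k. f j) = 0" using assms(1) by (intro sum.neutral) (force simp: less_le)
    then show False using assms by simp
  qed
  then have "M \<in> ?A" unfolding M_def by (intro Max_in) auto
  then show "1 \<le> M" "M \<le> k" "f M > 0" by auto
  fix j assume j: "M < j" "j \<le> k"
  have "j \<notin> ?A"
  proof
    assume "j \<in> ?A"
    then have "j \<le> M" unfolding M_def by (intro Max_ge) auto
    then show False using j by simp
  qed
  then show "f j = 0" using j assms(1) by (auto simp: less_le)
qed

locale random_leap =
  fixes k N :: nat and p q :: "nat \<Rightarrow> real"
  assumes k_pos: "k \<ge> 1"
    and p_nonneg: "\<forall>j\<in>{1..k}. p j \<ge> 0"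
    and q_nonneg: "\<forall>j\<in>{1..k}. q j \<ge> 0"
    and total: "(\<Sum>j = 1..k. p j + q j) = 1"
    and p_pos: "(\<Sum>j = 1..k. p j) > 0"
    and q_pos: "(\<Sum>j = 1..k. q j) > 0"
    and N_ge: "N \<ge> kp k p + kq k q"
begin

abbreviation "kP \<equiv> kp k p"
abbreviation "kQ \<equiv> kq k q"
abbreviation "r \<equiv> rr k p q"
abbreviation "\<gamma> \<equiv> gamma k p q"
abbreviation "\<psi> \<equiv> psi k p q"

section \<open>Range of the nonzero coefficients of psi\<close>

lemmas kP_facts = Max_support[OF p_nonneg p_pos, folded kp_def]
lemmas kQ_facts = Max_support[OF q_nonneg q_pos, folded kq_def]

lemma gamma_low: "j < k - kP \<Longrightarrow> \<gamma> j = 0"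
  unfolding gamma_def using kP_facts(4) by (auto intro!: sum.neutral)

lemma gamma_kP: "\<gamma> (k - kP) \<noteq> 0"
proof -
  have "(\<Sum>l = kP..k. p l) = (\<Sum>l\<in>{kP}. p l)"
    using kP_facts by (intro sum.mono_neutral_right) auto
  then show ?thesis unfolding gamma_def using kP_facts by auto
qed

lemma gamma_high: "k + kQ - 1 < j \<Longrightarrow> \<gamma> j = 0"
  unfolding gamma_def using kQ_facts(1,4) k_pos by (auto intro!: sum.neutral)

lemma gamma_kQ: "\<gamma> (k + kQ - 1) \<noteq> 0"
proof -
  have "(\<Sum>l = kQ..k. q l) = (\<Sum>l\<in>{kQ}. q l)"
    using kQ_facts by (intro sum.mono_neutral_right) auto
  moreover have "\<not> k + kQ - 1 \<le> k - 1" "k \<le> k + kQ - 1" "k + kQ - 1 \<le> 2 * k - 1"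
    "k + kQ - 1 - k + 1 = kQ" using kQ_facts by auto
  ultimately show ?thesis unfolding gamma_def using kQ_facts(3) by simp
qed

section \<open>Tail probabilities of the jump and of the reflected chain\<close>

definition upper_tail :: "int \<Rightarrow> real" where
  "upper_tail D = (\<Sum>d\<in>{- int k..int k}. if D \<le> d then xi_pmf k p q d else 0)"

lemma sum_xi_pos: "(\<Sum>d\<in>{D..int k}. xi_pmf k p q d) = (\<Sum>l = nat D..k. p l)" if "D \<ge> 1"
  by (rule sum.reindex_bij_witness[of _ int nat]) (use that in \<open>auto simp: xi_pmf_def\<close>)

lemma sum_xi_neg: "(\<Sum>d\<in>{- int k..D}. xi_pmf k p q d) = (\<Sum>l = nat (- D)..k. q l)" if "D \<le> -1"
  by (rule sum.reindex_bij_witness[of _ "\<lambda>l. - int l" "\<lambda>d. nat (- d)"])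
    (use that in \<open>auto simp: xi_pmf_def\<close>)

lemma sum_xi: "(\<Sum>d\<in>{- int k..int k}. xi_pmf k p q d) = 1"
proof -
  have "{- int k..int k} = {- int k..-1} \<union> ({0} \<union> {1..int k})" by auto
  then have "(\<Sum>d\<in>{- int k..int k}. xi_pmf k p q d)
     = (\<Sum>d\<in>{- int k..-1}. xi_pmf k p q d) + (\<Sum>d\<in>{0} \<union> {1..int k}. xi_pmf k p q d)"
    by (simp only:) (rule sum.union_disjoint, auto)
  also have "(\<Sum>d\<in>{0} \<union> {1..int k}. xi_pmf k p q d) = (\<Sum>d\<in>{1..int k}. xi_pmf k p q d)"
    by (rule sum.mono_neutral_right) (auto simp: xi_pmf_def)
  finally show ?thesis using total by (simp add: sum_xi_pos sum_xi_neg sum.distrib)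
qed

lemma upper_tail_pos: "D \<ge> 1 \<Longrightarrow> upper_tail D = (\<Sum>l = nat D..k. p l)"
  unfolding upper_tail_def sum_xi_pos[symmetric]
  by (rule sum.mono_neutral_cong) auto

lemma upper_tail_nonpos: "D \<le> 0 \<Longrightarrow> upper_tail D = 1 - (\<Sum>l = nat (1 - D)..k. q l)"
proof -
  assume D: "D \<le> 0"
  have "(\<Sum>d\<in>{- int k..int k}. xi_pmf k p q d) - upper_tail D
      = (\<Sum>d\<in>{- int k..int k}. if D \<le> d then 0 else xi_pmf k p q d)"
    unfolding upper_tail_def sum_subtractf[symmetric] by (rule sum.cong) auto
  also have "\<dots> = (\<Sum>d\<in>{- int k..D - 1}. xi_pmf k p q d)"
    using D by (intro sum.mono_neutral_cong) auto
  also have "\<dots> = (\<Sum>l = nat (1 - D)..k. q l)" using D sum_xi_neg[of "D - 1"] by simp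
  finally show ?thesis using sum_xi by simp
qed

text \<open>A state \<open>j - k + m\<close> lies \<open>D = k - m\<close> below the cut at
  \<open>j\<close>. If \<open>D \<ge> 1\<close> it can only cross upwards, with probability
  \<open>upper_tail D\<close>, counted negatively; otherwise it crosses downwards with probability
  \<open>1 - upper_tail D\<close>.\<close>

lemma gamma_eq_upper_tail:
  "m \<le> 2 * k - 1 \<Longrightarrow> \<gamma> m = (if k \<le> m then 1 else 0) - upper_tail (int k - int m)"
proof (cases "k \<le> m")
  case True
  then have "nat (1 - (int k - int m)) = m - k + 1" by auto
  moreover assume "m \<le> 2 * k - 1"
  ultimately show ?thesis using True k_pos by (auto simp: gamma_def upper_tail_nonpos)
next
  case False
  then have "nat (int k - int m) = k - m" by auto
  then show ?thesis using False by (auto simp: gamma_def upper_tail_pos)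
qed

lemma upper_tail_outside:
  "D > int k \<Longrightarrow> upper_tail D = 0" "D \<le> - int k \<Longrightarrow> upper_tail D = 1"
  by (auto simp: upper_tail_pos upper_tail_nonpos)

text \<open>The probability of moving from \<open>i\<close> into \<open>{j..N}\<close>. For
  \<open>1 \<le> j \<le> N\<close> this happens exactly when the free jump lands at or above
  \<open>j\<close>, so reflection enters only through the boundary values 1 and 0.\<close>

definition tail_trans :: "nat \<Rightarrow> nat \<Rightarrow> real" where
  "tail_trans i j = (if j = 0 then 1 else if j \<le> N then upper_tail (int j - int i) else 0)"

lemma leap_trans_eq:
  assumes "j \<le> N"
  shows "leap_trans k p q N i j = tail_trans i j - tail_trans i (Suc j)"
proof -
  have N0: "N > 0" using N_ge kP_facts by simp
  consider "j = 0" | "j = N" | "0 < j" "j < N" using assms by linarith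
  then show ?thesis
  proof cases
    case 1
    have "(\<Sum>d\<in>{- int k..int k}. if int i + d \<le> 0 then xi_pmf k p q d else 0) + upper_tail (1 - int i)
        = (\<Sum>d\<in>{- int k..int k}. xi_pmf k p q d)"
      unfolding upper_tail_def sum.distrib[symmetric] by (rule sum.cong) auto
    then show ?thesis using 1 N0 by (simp add: leap_trans_def tail_trans_def sum_xi)
  next
    case 2
    then show ?thesis using N0
      by (auto simp: leap_trans_def tail_trans_def upper_tail_def algebra_simps intro!: sum.cong)
  next
    case 3
    then show ?thesis
      by (auto simp: leap_trans_def tail_trans_def upper_tail_def sum_subtractf[symmetric] intro!: sum.cong)
  qed
qed

lemma leap_trans_row_sum: "(\<Sum>j\<le>N. leap_trans k p q N i j) = 1"
proof -
  have "(\<Sum>j\<le>N. leap_trans k p q N i j) = (\<Sum>j\<le>N. tail_trans i j - tail_trans i (Suc j))"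
    by (rule sum.cong) (auto simp: leap_trans_eq)
  also have "\<dots> = 1" by (subst sum_telescope) (simp add: tail_trans_def)
  finally show ?thesis .
qed

lemma xi_pmf_nonneg: "xi_pmf k p q d \<ge> 0"
proof -
  have "0 \<le> p (nat d)" if "0 < d" "d \<le> int k"
    by (rule p_nonneg[rule_format]) (use that in auto)
  moreover have "0 \<le> q (nat (- d))" if "d < 0" "- d \<le> int k"
    by (rule q_nonneg[rule_format]) (use that in auto)
  ultimately show ?thesis by (auto simp: xi_pmf_def)
qed

lemma leap_trans_nonneg: "leap_trans k p q N i j \<ge> 0"
  unfolding leap_trans_def by (auto intro!: sum_nonneg simp: xi_pmf_nonneg)

lemma leap_trans_upward:
  assumes "i < N"
  shows "\<exists>j. i < j \<and> j \<le> N \<and> leap_trans k p q N i j > 0"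
proof (intro exI conjI)
  \<comment> \<open>The largest upward jump, stopped at \<open>N\<close>.\<close>
  let ?j = "min (i + kP) N"
  show j: "i < ?j" "?j \<le> N" using assms kP_facts by auto
  have d: "int kP \<in> {- int k..int k}" "xi_pmf k p q (int kP) > 0"
    using kP_facts by (auto simp: xi_pmf_def)
  have *: "0 < (\<Sum>d\<in>{- int k..int k}. if C d then xi_pmf k p q d else 0)" if "C (int kP)" for C
    by (rule sum_pos2[OF _ d(1)]) (use d that xi_pmf_nonneg in auto)
  show "leap_trans k p q N i ?j > 0"
    unfolding leap_trans_def using j d by (auto simp: min_def intro!: *)
qed

sublocale stochastic_upward N "leap_trans k p q N"
  by unfold_locales (auto simp: leap_trans_nonneg leap_trans_row_sum leap_trans_upward)

text \<open>Net downward flow across the cut between \<open>j - 1\<close> and \<open>j\<close>;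
  jumps have size at most \<open>k\<close>, so only the states \<open>j - k\<close> to
  \<open>j + k - 1\<close> matter. On integer sequences it also expresses the recurrence with
  characteristic polynomial psi.\<close>

definition cut :: "(int \<Rightarrow> complex) \<Rightarrow> int \<Rightarrow> complex" where
  "cut u j = (\<Sum>m\<le>2 * k - 1. of_real (\<gamma> m) * u (j - int k + int m))"

lemma cut_eq_sum_states:
  assumes u: "\<And>e. e < 0 \<or> e > int N \<Longrightarrow> u e = 0"
  shows "cut u (int j) = (\<Sum>i\<le>N. of_real ((if j \<le> i then 1 else 0) - upper_tail (int j - int i)) * u (int i))"
proof -
  \<comment> \<open>One formula for the coefficient at any distance; it vanishes outside the window,
    so the summation range can be moved to \<open>{0..N}\<close>.\<close>
  define g where "g = (\<lambda>D::int. (if D \<le> 0 then 1 else 0) - upper_tail D)"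
  have "cut u (int j) = (\<Sum>e\<in>{int j - int k..int j + int k - 1}. of_real (g (int j - e)) * u e)"
    unfolding cut_def
    by (rule sum.reindex_bij_witness[of _ "\<lambda>e. nat (e - int j + int k)" "\<lambda>m. int j - int k + int m"])
      (use k_pos in \<open>auto simp: gamma_eq_upper_tail g_def\<close>)
  also have "\<dots> = (\<Sum>e\<in>{0..int N}. of_real (g (int j - e)) * u e)"
    by (rule sum.mono_neutral_cong) (auto simp: u g_def upper_tail_outside)
  also have "\<dots> = (\<Sum>i\<le>N. of_real (g (int j - int i)) * u (int i))"
    by (rule sum.reindex_bij_witness[of _ int nat]) auto
  finally show ?thesis by (simp add: g_def)
qed

text \<open>Zero flow means that one step preserves the mass of every upper set
  \<open>{j..N}\<close>; differences of consecutive upper sets give single states.\<close>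

lemma cut_imp_invariant:
  assumes u: "\<And>e. e < 0 \<or> e > int N \<Longrightarrow> u e = 0"
    and cut: "\<And>j. 1 \<le> j \<Longrightarrow> j \<le> N \<Longrightarrow> cut u (int j) = 0"
    and j: "j \<le> N"
  shows "(\<Sum>i\<le>N. u (int i) * of_real (leap_trans k p q N i j)) = u (int j)"
proof -
  have tail: "(\<Sum>i\<le>N. u (int i) * of_real (tail_trans i j)) = (\<Sum>i\<le>N. if j \<le> i then u (int i) else 0)" for j
  proof (cases "1 \<le> j \<and> j \<le> N")
    case True
    have "cut u (int j) = (\<Sum>i\<le>N. if j \<le> i then u (int i) else 0) - (\<Sum>i\<le>N. u (int i) * of_real (tail_trans i j))"
      unfolding cut_eq_sum_states[of u j, OF u, simplified] sum_subtractf[symmetric]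
      using True by (intro sum.cong) (auto simp: tail_trans_def algebra_simps)
    then show ?thesis using cut True by simp
  next
    case False
    then show ?thesis by (intro sum.cong) (auto simp: tail_trans_def)
  qed
  have "(\<Sum>i\<le>N. u (int i) * of_real (leap_trans k p q N i j))
     = (\<Sum>i\<le>N. u (int i) * of_real (tail_trans i j)) - (\<Sum>i\<le>N. u (int i) * of_real (tail_trans i (Suc j)))"
    unfolding sum_subtractf[symmetric] using j by (intro sum.cong) (auto simp: leap_trans_eq algebra_simps)
  also have "\<dots> = (\<Sum>i\<le>N. if i = j then u (int i) else 0)"
    unfolding tail sum_subtractf[symmetric] by (intro sum.cong) auto
  also have "\<dots> = u (int j)" using j by simp
  finally show ?thesis .
qed

text \<open>The entry of \<eta> at position \<open>e + kP - 1\<close>, re-indexed by the state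
  \<open>e\<close> whose difference it multiplies.\<close>

definition eta_tail :: "nat \<Rightarrow> real" where
  "eta_tail e = (\<Sum>l = e..kQ. (real l - real e + 1) * q l)"

lemma eta_tail_diff: "eta_tail e - eta_tail (Suc e) = (\<Sum>l = e..kQ. q l)"
proof -
  have "eta_tail (Suc e) = (\<Sum>l = e..kQ. (real l - real e) * q l)"
    unfolding eta_tail_def by (rule sum.mono_neutral_cong_left) (auto simp: not_less_eq_eq le_Suc_eq)
  then show ?thesis unfolding eta_tail_def by (simp add: sum_subtractf[symmetric] algebra_simps)
qed

text \<open>Summation by parts turns the flow through the first cut into a combination of
  differences; with \<open>t = - u 0\<close> this is the last row of W.\<close>

lemma cut_1_eq:
  assumes u: "\<And>e. e < 0 \<Longrightarrow> u e = 0"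
  shows "cut u 1 = (\<Sum>e = 1..kQ. of_real (eta_tail e) * (u (int e) - u (int e - 1)))
     - of_real ((\<Sum>l = 1..kP. p l) - eta_tail 1) * u 0"
proof -
  have P: "(\<Sum>l = 1..k. p l) = (\<Sum>l = 1..kP. p l)"
    using kP_facts by (intro sum.mono_neutral_right) auto
  have Q: "(\<Sum>l = e..k. q l) = (\<Sum>l = e..kQ. q l)" for e
    using kQ_facts by (intro sum.mono_neutral_right) auto
  have "cut u 1 = (\<Sum>e = 0..k. of_real (\<gamma> (k + e - 1)) * u (int e))"
    unfolding cut_def
  proof (rule sum.mono_neutral_cong_right[THEN trans, of _ "{k - 1..2 * k - 1}"])
    \<comment> \<open>Indices below \<open>k - 1\<close> address negative states, where
      \<open>u\<close> vanishes; index \<open>k - 1\<close> is state 0.\<close>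
    show "\<forall>m\<in>{..2 * k - 1} - {k - 1..2 * k - 1}. of_real (\<gamma> m) * u (1 - int k + int m) = 0"
      using k_pos by (auto simp: u)
    show "(\<Sum>m = k - 1..2 * k - 1. of_real (\<gamma> m) * u (1 - int k + int m))
      = (\<Sum>e = 0..k. of_real (\<gamma> (k + e - 1)) * u (int e))"
      by (rule sum.reindex_bij_witness[of _ "\<lambda>e. k + e - 1" "\<lambda>m. m + 1 - k"])
        (use k_pos in \<open>auto simp: of_nat_diff algebra_simps\<close>)
  qed auto
  also have "\<dots> = of_real (\<gamma> (k - 1)) * u 0 + (\<Sum>e = 1..k. of_real (\<gamma> (k + e - 1)) * u (int e))"
    by (simp add: sum.atLeast_Suc_atMost)
  also have "(\<Sum>e = 1..k. of_real (\<gamma> (k + e - 1)) * u (int e)) = (\<Sum>e = 1..kQ. of_real (\<gamma> (k + e - 1)) * u (int e))"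
    using kQ_facts gamma_high by (intro sum.mono_neutral_right) auto
  also have "\<dots> = (\<Sum>e = 1..kQ. (of_real (eta_tail e) - of_real (eta_tail (Suc e))) * u (int e))"
  proof (rule sum.cong[OF refl])
    fix e assume e: "e \<in> {1..kQ}"
    then have "\<not> k + e - 1 \<le> k - 1" "k \<le> k + e - 1" "k + e - 1 \<le> 2 * k - 1" "k + e - 1 - k + 1 = e"
      using kQ_facts k_pos by auto
    then have "\<gamma> (k + e - 1) = eta_tail e - eta_tail (Suc e)"
      unfolding gamma_def eta_tail_diff Q[symmetric] by simp
    then show "of_real (\<gamma> (k + e - 1)) * u (int e) = (of_real (eta_tail e) - of_real (eta_tail (Suc e))) * u (int e)"
      by simp
  qed
  also have "\<gamma> (k - 1) = - (\<Sum>l = 1..kP. p l)" using k_pos P by (simp add: gamma_def)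
  finally have c: "cut u 1 = - of_real (\<Sum>l = 1..kP. p l) * u 0
    + (\<Sum>e = 1..kQ. (of_real (eta_tail e) - of_real (eta_tail (Suc e))) * u (int e))" by simp
  have "eta_tail (Suc kQ) = 0" by (simp add: eta_tail_def)
  then show ?thesis
    unfolding c sum_by_parts_complex[of "\<lambda>e. of_real (eta_tail e)"] by (simp add: algebra_simps)
qed

text \<open>\<open>X\<close> plays the role of the difference sequence of a zero-extended invariant vector whose value
  at \<open>0\<close> is \<open>- t\<close>.\<close>

definition partial_sums :: "(int \<Rightarrow> complex) \<Rightarrow> complex \<Rightarrow> int \<Rightarrow> complex" where
  "partial_sums X t e = (if 0 \<le> e \<and> e \<le> int N then (\<Sum>j = 1..nat e. X (int j)) - t else 0)"

text \<open>Truncation to \<open>{0..N}\<close> creates jumps at 0 and at \<open>N + 1\<close>;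
  \<open>zero\<close> and \<open>full\<close> say that \<open>X\<close> has exactly these values
  there. The guards \<open>kP \<ge> 2\<close> and \<open>kQ \<ge> 2\<close> state when these
  positions lie in the range of \<open>e\<close>.\<close>

lemma partial_sums_diff:
  assumes left: "\<And>e. 2 - int kP \<le> e \<Longrightarrow> e < 0 \<Longrightarrow> X e = 0"
    and zero: "kP \<ge> 2 \<Longrightarrow> X 0 + t = 0"
    and full: "kQ \<ge> 2 \<Longrightarrow> (\<Sum>j = 1..N + 1. X (int j)) - t = 0"
    and right: "\<And>e. int N + 2 \<le> e \<Longrightarrow> e \<le> int N + int kQ - 1 \<Longrightarrow> X e = 0"
    and e: "2 - int kP \<le> e" "e \<le> int N + int kQ - 1"
  shows "partial_sums X t e - partial_sums X t (e - 1) = X e"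
proof -
  consider "e < 0" | "e = 0" | "1 \<le> e" "e \<le> int N" | "e = int N + 1" | "int N + 2 \<le> e" by linarith
  then show ?thesis
  proof cases
    case 1
    then show ?thesis using left e by (simp add: partial_sums_def)
  next
    case 2
    then show ?thesis using zero e by (simp add: partial_sums_def add_eq_0_iff)
  next
    case 3
    then have "e = int (Suc (nat (e - 1)))" by simp
    then obtain n where n: "e = int (Suc n)" by blast
    show ?thesis using 3 unfolding n by (simp add: partial_sums_def nat_add_distrib)
  next
    case 4
    then show ?thesis using full e by (simp add: partial_sums_def algebra_simps)
  next
    case 5
    then show ?thesis using right e by (simp add: partial_sums_def)
  qed
qed

text \<open>Induction on the cut: \<open>eta\<close> settles the first one, and consecutive flows
  differ by \<open>cut X\<close>, which is 0 by \<open>rec\<close>.\<close>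

lemma partial_sums_cut:
  assumes left: "\<And>e. 2 - int kP \<le> e \<Longrightarrow> e < 0 \<Longrightarrow> X e = 0"
    and zero: "kP \<ge> 2 \<Longrightarrow> X 0 + t = 0"
    and full: "kQ \<ge> 2 \<Longrightarrow> (\<Sum>j = 1..N + 1. X (int j)) - t = 0"
    and right: "\<And>e. int N + 2 \<le> e \<Longrightarrow> e \<le> int N + int kQ - 1 \<Longrightarrow> X e = 0"
    and eta: "(\<Sum>e = 1..kQ. of_real (eta_tail e) * X (int e)) + of_real ((\<Sum>l = 1..kP. p l) - eta_tail 1) * t = 0"
    and rec: "\<And>j. cut X j = 0"
    and j: "1 \<le> j" "j \<le> N"
  shows "cut (partial_sums X t) (int j) = 0"
proof -
  let ?u = "partial_sums X t"
  have diff: "?u e - ?u (e - 1) = X e" if "2 - int kP \<le> e" "e \<le> int N + int kQ - 1" for e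
    by (rule partial_sums_diff[OF left zero full right that])
  show ?thesis using j
  proof (induction j rule: nat_induct_at_least)
    case base
    have "(\<Sum>e = 1..kQ. of_real (eta_tail e) * (?u (int e) - ?u (int e - 1))) = (\<Sum>e = 1..kQ. of_real (eta_tail e) * X (int e))"
      using N_ge kP_facts by (intro sum.cong) (auto simp: diff)
    moreover have "?u 0 = - t" "\<And>e. e < 0 \<Longrightarrow> ?u e = 0" by (auto simp: partial_sums_def)
    ultimately show ?case using eta cut_1_eq[of ?u] by simp
  next
    case (Suc j)
    have "cut ?u (int (Suc j)) - cut ?u (int j) = cut X (int (Suc j))"
      unfolding cut_def sum_subtractf[symmetric]
    proof (rule sum.cong[OF refl])
      fix m
      show "of_real (\<gamma> m) * ?u (int (Suc j) - int k + int m) - of_real (\<gamma> m) * ?u (int j - int k + int m)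
         = of_real (\<gamma> m) * X (int (Suc j) - int k + int m)"
      proof (cases "\<gamma> m = 0")
        case False
        \<comment> \<open>The nonzero coefficients reach only from \<open>j + 1 - kP\<close> to
          \<open>j + kQ\<close>, which for \<open>1 \<le> j < N\<close> stays where the differences
          are known.\<close>
        then have "k - kP \<le> m" "m \<le> k + kQ - 1" using gamma_low gamma_high by (meson not_le)+
        then have "2 - int kP \<le> int (Suc j) - int k + int m" "int (Suc j) - int k + int m \<le> int N + int kQ - 1"
          using Suc kP_facts kQ_facts by auto
        from diff[OF this] show ?thesis by (simp add: algebra_simps flip: right_diff_distrib)
      qed simp
    qed
    then show ?case using Suc rec by simp
  qed
qed

end

section \<open>The determinants\<close>

text \<open>This is column \<open>s\<close> of \<open>A * adj A = det A * I\<close>: row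
  \<open>s\<close> meets its own cofactors, every other row meets alien ones.\<close>

lemma mult_mat_vec_cofactors:
  fixes A :: "'a::comm_ring_1 mat"
  assumes A: "A \<in> carrier_mat n n" and s: "s < n"
  shows "A *\<^sub>v vec n (cofactor A s) = det A \<cdot>\<^sub>v unit_vec n s"
proof -
  have "vec n (cofactor A s) = col (adj_mat A) s"
    using A s by (intro eq_vecI) (auto simp: adj_mat_def)
  then have "A *\<^sub>v vec n (cofactor A s) = col (A * adj_mat A) s"
    using A s adj_mat(1)[OF A] by (auto intro!: eq_vecI)
  also have "\<dots> = det A \<cdot>\<^sub>v unit_vec n s"
    unfolding adj_mat(2)[OF A] using s by (intro eq_vecI) (auto simp: unit_vec_def)
  finally show ?thesis .
qed

lemma cofactor_cong_row:
  assumes "A \<in> carrier_mat n n" "B \<in> carrier_mat n n" "s < n" "j < n"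
    and "\<And>m a. m < n \<Longrightarrow> a < n \<Longrightarrow> m \<noteq> s \<Longrightarrow> A $$ (m, a) = B $$ (m, a)"
  shows "cofactor A s j = cofactor B s j"
proof -
  have "mat_delete A s j = mat_delete B s j"
    unfolding mat_delete_def using assms by (intro eq_matI) auto
  then show ?thesis by (simp add: cofactor_def)
qed

locale random_leap_roots = random_leap +
  fixes ys :: "complex list"
  assumes ys_distinct: "distinct ys"
    and ys_roots: "set ys = {y. y \<noteq> 0 \<and> poly (psi k p q) y = 0}"
begin

abbreviation "W \<equiv> Wmat k p q N ys"

section \<open>Roots of psi and the solutions they generate\<close>

lemma coeff_psi: "coeff \<psi> m = of_real (\<gamma> m)"
proof -
  have "coeff \<psi> m = (if m \<le> 2 * k - 1 then of_real (\<gamma> m) else 0)"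
    by (simp add: psi_def coeff_sum)
  moreover have "\<gamma> m = 0" if "\<not> m \<le> 2 * k - 1" using that kQ_facts by (intro gamma_high) auto
  ultimately show ?thesis by auto
qed

lemma psi_nonzero: "\<psi> \<noteq> 0"
  using coeff_psi[of "k - kP"] gamma_kP by auto

lemma degree_psi: "degree \<psi> = k + kQ - 1"
  using gamma_kQ by (intro antisym degree_le le_degree) (auto simp: coeff_psi gamma_high)

lemma order_0_psi: "order 0 \<psi> = k - kP"
proof (rule antisym)
  show "k - kP \<le> order 0 \<psi>"
    unfolding monom_1_dvd_iff[OF psi_nonzero, symmetric] monom_1_dvd_iff' by (simp add: coeff_psi gamma_low)
  have "\<not> Suc (k - kP) \<le> order 0 \<psi>"
    unfolding monom_1_dvd_iff[OF psi_nonzero, symmetric] monom_1_dvd_iff'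
    using gamma_kP by (auto simp: coeff_psi)
  then show "order 0 \<psi> \<le> k - kP" by simp
qed

text \<open>The degree \<open>k + kQ - 1\<close> minus the order \<open>k - kP\<close> at 0; so Y
  has exactly \<open>r\<close> columns.\<close>

lemma sum_order_ys: "(\<Sum>y\<in>set ys. order y \<psi>) = r"
  using sum_order_nonzero_roots_complex[OF psi_nonzero] kP_facts kQ_facts
  unfolding ys_roots degree_psi order_0_psi rr_def by auto

lemma length_Y_cols: "length (Y_cols \<psi> ys) = r"
proof -
  have "length (Y_cols \<psi> ys) = sum_list (map (\<lambda>y. order y \<psi>) ys)"
    by (simp add: Y_cols_def length_concat comp_def del: upt_Suc)
  then show ?thesis using sum_order_ys ys_distinct by (simp add: sum_list_distinct_conv_sum_set)
qed

lemma set_Y_cols: "set (Y_cols \<psi> ys) = {(y, l). y \<in> set ys \<and> 1 \<le> l \<and> l \<le> order y \<psi>}"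
  by (auto simp: Y_cols_def simp del: upt_Suc)

text \<open>Column \<open>a\<close> of Y continued to all integers; its 0-based row \<open>b\<close>
  is the value at \<open>e = b + 2 - kP\<close>.\<close>

definition basis :: "nat \<Rightarrow> int \<Rightarrow> complex" where
  "basis a e = of_int e ^ (snd (Y_cols \<psi> ys ! a) - 1) * fst (Y_cols \<psi> ys ! a) powi e"

text \<open>The multiplicity of the root exceeds the exponent \<open>l\<close>, so the
  \<open>l\<close>-th moment of the coefficients of psi vanishes for every shift.\<close>

lemma cut_basis:
  assumes a: "a < r"
  shows "cut (basis a) j = 0"
proof -
  define y where "y = fst (Y_cols \<psi> ys ! a)"
  define l where "l = snd (Y_cols \<psi> ys ! a) - 1"
  have "Y_cols \<psi> ys ! a \<in> set (Y_cols \<psi> ys)" using a length_Y_cols by simp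
  then have y: "y \<in> set ys" and l: "l < order y \<psi>"
    unfolding set_Y_cols y_def l_def by auto
  from y have y0: "y \<noteq> 0" by (simp add: ys_roots)
  have "degree \<psi> \<le> 2 * k - 1" using degree_psi kQ_facts by simp
  \<comment> \<open>The shift \<open>j - k\<close> and the factor \<open>y powi (j - k)\<close> move
    the moment to the window of the cut at \<open>j\<close>.\<close>
  from linear_power_dvd_iff_moments[OF y0 this, of "order y \<psi>" "of_int (j - int k)"] l
  have "(\<Sum>m\<le>2 * k - 1. coeff \<psi> m * (of_int (j - int k) + of_nat m) ^ l * y ^ m) = 0"
    using order_1[of y \<psi>] by simp
  then have "0 = y powi (j - int k) * (\<Sum>m\<le>2 * k - 1. coeff \<psi> m * (of_int (j - int k) + of_nat m) ^ l * y ^ m)"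
    by simp
  also have "\<dots> = cut (basis a) j"
    unfolding cut_def basis_def y_def[symmetric] l_def[symmetric] sum_distrib_left
    using y0 by (simp add: coeff_psi power_int_add mult_ac)
  finally show ?thesis by simp
qed

text \<open>The sequence \<open>Y c\<close>, where \<open>c\<close> consists of the first
  \<open>r\<close> entries of \<open>v\<close>; in a vector of length \<open>r + 1\<close> the last
  entry \<open>v $ r\<close> is \<open>t\<close>.\<close>

definition combo :: "complex vec \<Rightarrow> int \<Rightarrow> complex" where
  "combo v e = (\<Sum>a<r. v $ a * basis a e)"

lemma cut_combo: "cut (combo v) j = 0"
proof -
  have "cut (combo v) j = (\<Sum>m\<le>2 * k - 1. \<Sum>a<r. v $ a * (of_real (\<gamma> m) * basis a (j - int k + int m)))"
    by (simp add: cut_def combo_def sum_distrib_left mult_ac)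
  also have "\<dots> = (\<Sum>a<r. v $ a * cut (basis a) j)"
    unfolding cut_def sum_distrib_left by (rule sum.swap)
  finally show ?thesis using cut_basis by simp
qed

lemma r_pos: "r \<ge> 1" using kP_facts kQ_facts by (simp add: rr_def)

text \<open>A vanishing linear combination of the rows of the confluent Vandermonde matrix is a polynomial
  of degree below \<open>r\<close> with \<open>r\<close> roots, counted with multiplicity.\<close>

lemma combo_injective:
  assumes z: "\<And>e. 2 - int kP \<le> e \<Longrightarrow> e \<le> int kQ \<Longrightarrow> combo v e = 0" and a: "a < r"
  shows "v $ a = 0"
proof (rule ccontr)
  assume va: "v $ a \<noteq> 0"
  \<comment> \<open>The \<open>r\<close> consecutive positions \<open>2 - kP\<close> to
    \<open>kQ\<close> give a square matrix.\<close>
  define M where "M = mat r r (\<lambda>(i, a). basis a (int i + 2 - int kP))"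
  have M: "M \<in> carrier_mat r r" by (simp add: M_def)
  define x where "x = vec r (($) v)"
  have "M *\<^sub>v x = 0\<^sub>v r"
  proof (rule eq_vecI)
    fix i assume "i < dim_vec (0\<^sub>v r :: complex vec)"
    then have i: "i < r" by simp
    have "(M *\<^sub>v x) $ i = combo v (int i + 2 - int kP)"
      using i by (simp add: M_def x_def scalar_prod_def combo_def atLeast0LessThan mult.commute)
    also have "\<dots> = 0" using i kP_facts kQ_facts by (intro z) (auto simp: rr_def)
    finally show "(M *\<^sub>v x) $ i = 0\<^sub>v r $ i" using i by simp
  qed (simp add: M_def)
  moreover have "x \<in> carrier_vec r" by (simp add: x_def)
  moreover have "x \<noteq> 0\<^sub>v r"
  proof
    assume "x = 0\<^sub>v r"
    then have "x $ a = 0\<^sub>v r $ a" by simp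
    then show False using a va by (simp add: x_def)
  qed
  ultimately have "det M = 0" using det_0_iff_vec_prod_zero[OF M] by blast
  then have "det M\<^sup>T = 0" using det_transpose[OF M] by simp
  \<comment> \<open>Singularity is traded for a left null vector, whose entries become the
    coefficients of a polynomial.\<close>
  then obtain w where w: "w \<in> carrier_vec r" "w \<noteq> 0\<^sub>v r" "M\<^sup>T *\<^sub>v w = 0\<^sub>v r"
    using det_0_iff_vec_prod_zero[of "M\<^sup>T" r] M by auto
  define f where "f = (\<Sum>i<r. monom (w $ i) i)"
  have cf: "coeff f i = (if i < r then w $ i else 0)" for i
    by (simp add: f_def coeff_sum)
  have deg: "degree f \<le> r - 1" using r_pos by (intro degree_le) (auto simp: cf)
  have f0: "f \<noteq> 0"
  proof
    assume "f = 0"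
    then have "w $ i = 0" if "i < r" for i using cf[of i] that by simp
    then have "w = 0\<^sub>v r" using w(1) by (intro eq_vecI) auto
    then show False using w by simp
  qed
  have "order y \<psi> \<le> order y f" if y: "y \<in> set ys" for y
  proof -
    from y have y0: "y \<noteq> 0" by (simp add: ys_roots)
    have "(\<Sum>i\<le>r - 1. coeff f i * (of_int (2 - int kP) + of_nat i) ^ m * y ^ i) = 0" if m: "m < order y \<psi>" for m
    proof -
      \<comment> \<open>The column for \<open>(y, m + 1)\<close> has factor \<open>e ^ m\<close>, so
        \<open>w\<close> annihilating it is the \<open>m\<close>-th moment condition for
        \<open>f\<close>.\<close>
      have "(y, Suc m) \<in> set (Y_cols \<psi> ys)" using y m by (simp add: set_Y_cols)
      then obtain b where b: "b < r" "Y_cols \<psi> ys ! b = (y, Suc m)"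
        unfolding in_set_conv_nth length_Y_cols by blast
      have "0 = (M\<^sup>T *\<^sub>v w) $ b" using w b by simp
      also have "\<dots> = (\<Sum>i<r. basis b (int i + 2 - int kP) * w $ i)"
        using b w(1) by (simp add: M_def scalar_prod_def atLeast0LessThan)
      also have "\<dots> = (\<Sum>i\<le>r - 1. y powi (2 - int kP) * (coeff f i * (of_int (2 - int kP) + of_nat i) ^ m * y ^ i))"
      proof (rule sum.cong)
        fix i assume "i \<in> {..r - 1}"
        then have i: "i < r" using r_pos by auto
        have "int i + 2 - int kP = (2 - int kP) + int i" by simp
        then show "basis b (int i + 2 - int kP) * w $ i
           = y powi (2 - int kP) * (coeff f i * (of_int (2 - int kP) + of_nat i) ^ m * y ^ i)"
          using y0 i by (simp only: basis_def b) (simp add: cf power_int_add mult_ac)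
      qed (use r_pos in auto)
      finally show ?thesis using y0 by (simp add: sum_distrib_left[symmetric])
    qed
    then have "[:-y, 1:] ^ order y \<psi> dvd f"
      using linear_power_dvd_iff_moments[OF y0 deg, of _ "of_int (2 - int kP)"] by blast
    then show ?thesis using f0 by (simp add: order_divides)
  qed
  then have "r \<le> (\<Sum>y\<in>set ys. order y f)" unfolding sum_order_ys[symmetric] by (rule sum_mono)
  also have "\<dots> \<le> degree f" by (rule sum_order_le_degree[OF f0]) simp
  finally show False using deg r_pos by simp
qed

section \<open>Rows of W acting on a vector\<close>

lemma Wmat_carrier: "W i \<in> carrier_mat (Suc r) (Suc r)"
  by (rule carrier_matI) (auto simp: Wmat_def Adag_def Ymat_def)

lemma Ymat_index:
  "b < N + r - 1 \<Longrightarrow> a < r \<Longrightarrow> Ymat k p q N ys $$ (b, a) = basis a (int b + 2 - int kP)"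
  by (simp add: Ymat_def basis_def Let_def case_prod_beta algebra_simps)

lemma mult_Ymat_combo:
  "(\<Sum>a<r. (\<Sum>b<N + r - 1. h b * basis a (int b + 2 - int kP)) * v $ a)
    = (\<Sum>b<N + r - 1. h b * combo v (int b + 2 - int kP))"
  unfolding combo_def sum_distrib_left sum_distrib_right
  by (subst sum.swap) (simp add: mult_ac)

lemma Wmat_mult_upper:
  assumes v: "v \<in> carrier_vec (Suc r)" and m: "m < r"
  shows "(W i *\<^sub>v v) $ m
    = (\<Sum>b<N + r - 1. Adag_entry kP kQ N i (m + 1) (b + 1) * combo v (int b + 2 - int kP))
      + e_col k p q $$ (m, 0) * v $ r"
proof -
  have "(W i *\<^sub>v v) $ m = (\<Sum>a<Suc r. W i $$ (m, a) * v $ a)"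
    using Wmat_carrier[of i] v m by (simp add: scalar_prod_def atLeast0LessThan)
  also have "\<dots> = (\<Sum>a<r. W i $$ (m, a) * v $ a) + e_col k p q $$ (m, 0) * v $ r"
    using m by (simp add: Wmat_def Adag_def Ymat_def eta_row_def)
  also have "(\<Sum>a<r. W i $$ (m, a) * v $ a)
    = (\<Sum>a<r. (\<Sum>b<N + r - 1. Adag_entry kP kQ N i (m + 1) (b + 1) * basis a (int b + 2 - int kP)) * v $ a)"
  proof (rule sum.cong[OF refl])
    fix a assume a: "a \<in> {..<r}"
    have "W i $$ (m, a) = (Adag k p q N i * Ymat k p q N ys) $$ (m, a)"
      using a m by (simp add: Wmat_def Adag_def Ymat_def)
    also have "\<dots> = (\<Sum>b<N + r - 1. Adag_entry kP kQ N i (m + 1) (b + 1) * Ymat k p q N ys $$ (b, a))"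
      using a m by (simp add: scalar_prod_def Adag_def Ymat_def atLeast0LessThan)
    finally show "W i $$ (m, a) * v $ a = (\<Sum>b<N + r - 1. Adag_entry kP kQ N i (m + 1) (b + 1) * basis a (int b + 2 - int kP)) * v $ a"
      using a by (simp add: Ymat_index)
  qed
  finally show ?thesis by (simp only: mult_Ymat_combo)
qed

lemma Wmat_mult_last:
  assumes v: "v \<in> carrier_vec (Suc r)"
  shows "(W i *\<^sub>v v) $ r
    = (\<Sum>e = 1..kQ. of_real (eta_tail e) * combo v (int e)) + of_real ((\<Sum>l = 1..kP. p l) - eta_tail 1) * v $ r"
proof -
  have "(W i *\<^sub>v v) $ r = (\<Sum>a<Suc r. W i $$ (r, a) * v $ a)"
    using Wmat_carrier[of i] v by (simp add: scalar_prod_def atLeast0LessThan)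
  also have "\<dots> = (\<Sum>a<r. W i $$ (r, a) * v $ a) + of_real ((\<Sum>l = 1..kP. p l) - eta_tail 1) * v $ r"
    by (simp add: Wmat_def Adag_def Ymat_def eta_row_def eta_tail_def)
  also have "(\<Sum>a<r. W i $$ (r, a) * v $ a)
    = (\<Sum>a<r. (\<Sum>b<N + r - 1. of_real (eta_entry k p q (b + 1)) * basis a (int b + 2 - int kP)) * v $ a)"
  proof (rule sum.cong[OF refl])
    fix a assume a: "a \<in> {..<r}"
    have "W i $$ (r, a) = (eta_row k p q N * Ymat k p q N ys) $$ (0, a)"
      using a by (simp add: Wmat_def Adag_def Ymat_def)
    also have "\<dots> = (\<Sum>b<N + r - 1. of_real (eta_entry k p q (b + 1)) * Ymat k p q N ys $$ (b, a))"
      using a by (simp add: scalar_prod_def eta_row_def Ymat_def atLeast0LessThan)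
    finally show "W i $$ (r, a) * v $ a = (\<Sum>b<N + r - 1. of_real (eta_entry k p q (b + 1)) * basis a (int b + 2 - int kP)) * v $ a"
      using a by (simp add: Ymat_index)
  qed
  also have "\<dots> = (\<Sum>b<N + r - 1. of_real (eta_entry k p q (b + 1)) * combo v (int b + 2 - int kP))"
    by (rule mult_Ymat_combo)
  also have "\<dots> = (\<Sum>b\<in>{kP - 1..<r}. of_real (eta_entry k p q (b + 1)) * combo v (int b + 2 - int kP))"
    using N_ge kP_facts by (intro sum.mono_neutral_right) (auto simp: eta_entry_def)
  also have "\<dots> = (\<Sum>e = 1..kQ. of_real (eta_tail e) * combo v (int e))"
    by (rule sum.reindex_bij_witness[of _ "\<lambda>e. e + kP - 2" "\<lambda>b. b + 2 - kP"])
      (use kP_facts in \<open>auto simp: rr_def eta_entry_def eta_tail_def of_nat_diff Suc_diff_le algebra_simps\<close>)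
  finally show ?thesis .
qed

text \<open>The first identity block reads off positions \<open>2 - kP\<close> to 0; the last column
  adds \<open>t\<close> at position 0 only, the case \<open>m + 2 = kP\<close>.\<close>

lemma Wmat_mult_left:
  assumes v: "v \<in> carrier_vec (Suc r)" and m: "m + 1 < kP"
  shows "(W i *\<^sub>v v) $ m = combo v (int m + 2 - int kP) + (if m + 2 = kP then v $ r else 0)"
proof -
  have mr: "m < r" using m kQ_facts by (simp add: rr_def)
  have "(\<Sum>b<N + r - 1. Adag_entry kP kQ N i (m + 1) (b + 1) * combo v (int b + 2 - int kP))
    = (\<Sum>b<N + r - 1. if b = m then combo v (int b + 2 - int kP) else 0)"
    using m by (intro sum.cong) (auto simp: Adag_entry_def)
  also have "\<dots> = combo v (int m + 2 - int kP)" using mr N_ge kP_facts by simp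
  finally show ?thesis unfolding Wmat_mult_upper[OF v mr] using m mr by (auto simp: e_col_def)
qed

lemma sum_window:
  assumes "j \<le> N + kQ - 1"
  shows "(\<Sum>b<N + r - 1. (if kP - 1 + i \<le> b \<and> b + 1 < kP + j then 1 else 0) * combo v (int b + 2 - int kP))
    = (\<Sum>e = Suc i..j. combo v (int e))"
proof -
  have "(\<Sum>b<N + r - 1. (if kP - 1 + i \<le> b \<and> b + 1 < kP + j then 1 else 0) * combo v (int b + 2 - int kP))
    = (\<Sum>b\<in>{kP - 1 + i..<kP - 1 + j}. combo v (int b + 2 - int kP))"
    by (rule sum.mono_neutral_cong_right) (use assms kP_facts in \<open>auto simp: rr_def\<close>)
  also have "\<dots> = (\<Sum>e = Suc i..j. combo v (int e))"
    by (rule sum.reindex_bij_witness[of _ "\<lambda>e. e + kP - 2" "\<lambda>b. b + 2 - kP"])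
      (use kP_facts in \<open>auto simp: of_nat_diff algebra_simps\<close>)
  finally show ?thesis .
qed

lemma Wmat_mult_kP:
  assumes v: "v \<in> carrier_vec (Suc r)" and i: "i \<le> N"
  shows "(W i *\<^sub>v v) $ (kP - 1) = (\<Sum>e = 1..i. combo v (int e)) - v $ r"
proof -
  have mr: "kP - 1 < r" using kP_facts kQ_facts by (simp add: rr_def)
  have "(\<Sum>b<N + r - 1. Adag_entry kP kQ N i (kP - 1 + 1) (b + 1) * combo v (int b + 2 - int kP))
    = (\<Sum>b<N + r - 1. (if kP - 1 + 0 \<le> b \<and> b + 1 < kP + i then 1 else 0) * combo v (int b + 2 - int kP))"
    using kP_facts by (intro sum.cong) (auto simp: Adag_entry_def)
  also have "\<dots> = (\<Sum>e = 1..i. combo v (int e))" using sum_window[of i 0 v] i kQ_facts by simp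
  finally show ?thesis unfolding Wmat_mult_upper[OF v mr] using kP_facts mr by (auto simp: e_col_def)
qed

lemma Wmat_mult_Suc_kP:
  assumes v: "v \<in> carrier_vec (Suc r)" and i: "i \<le> N" and kQ: "kQ \<ge> 2"
  shows "(W i *\<^sub>v v) $ kP = (\<Sum>e = Suc i..N + 1. combo v (int e))"
proof -
  have mr: "kP < r" using kP_facts kQ by (simp add: rr_def)
  have "(\<Sum>b<N + r - 1. Adag_entry kP kQ N i (kP + 1) (b + 1) * combo v (int b + 2 - int kP))
    = (\<Sum>b<N + r - 1. (if kP - 1 + i \<le> b \<and> b + 1 < kP + (N + 1) then 1 else 0) * combo v (int b + 2 - int kP))"
    using kP_facts kQ by (intro sum.cong) (auto simp: Adag_entry_def)
  also have "\<dots> = (\<Sum>e = Suc i..N + 1. combo v (int e))" using sum_window[of "N + 1" i v] kQ by simp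
  finally show ?thesis unfolding Wmat_mult_upper[OF v mr] using kP_facts mr by (auto simp: e_col_def)
qed

lemma Wmat_mult_right:
  assumes v: "v \<in> carrier_vec (Suc r)" and m: "kP < m" "m < r"
  shows "(W i *\<^sub>v v) $ m = combo v (int m + int N + 1 - int kP)"
proof -
  have "(\<Sum>b<N + r - 1. Adag_entry kP kQ N i (m + 1) (b + 1) * combo v (int b + 2 - int kP))
    = (\<Sum>b<N + r - 1. if b = m + N - 1 then combo v (int b + 2 - int kP) else 0)"
    using m by (intro sum.cong) (auto simp: Adag_entry_def)
  also have "\<dots> = combo v (int (m + N - 1) + 2 - int kP)" using m N_ge kP_facts by simp
  also have "int (m + N - 1) + 2 - int kP = int m + int N + 1 - int kP" using m by simp
  finally show ?thesis unfolding Wmat_mult_upper[OF v m(2)] using m by (auto simp: e_col_def)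
qed

text \<open>Adding row \<open>kP\<close> (index \<open>kP - 1\<close>) to the next one leaves it as the only row that
  depends on \<open>i\<close>.\<close>

definition V :: "nat \<Rightarrow> complex mat" where
  "V i = (if kQ \<ge> 2 then addrow 1 kP (kP - 1) (W i) else W i)"

lemma V_carrier: "V i \<in> carrier_mat (Suc r) (Suc r)"
  using Wmat_carrier by (simp add: V_def)

lemma det_V: "det (V i) = det (W i)"
  unfolding V_def using det_addrow[OF _ _ Wmat_carrier] kP_facts kQ_facts by (auto simp: rr_def)

lemma V_mult_same:
  assumes v: "v \<in> carrier_vec (Suc r)" and m: "m < Suc r" "m = kP \<Longrightarrow> kQ < 2"
  shows "(V i *\<^sub>v v) $ m = (W i *\<^sub>v v) $ m"
  using Wmat_carrier[of i] v m by (auto simp: V_def scalar_prod_def)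

text \<open>The windows \<open>{1..i}\<close> and \<open>{i + 1..N + 1}\<close> of the two accordion
  rows join to one that does not involve \<open>i\<close>.\<close>

lemma V_mult_kP:
  assumes v: "v \<in> carrier_vec (Suc r)" and i: "i \<le> N" and kQ: "kQ \<ge> 2"
  shows "(V i *\<^sub>v v) $ kP = (\<Sum>e = 1..N + 1. combo v (int e)) - v $ r"
proof -
  have "kP < Suc r" using kQ by (simp add: rr_def)
  then have "(V i *\<^sub>v v) $ kP = (W i *\<^sub>v v) $ (kP - 1) + (W i *\<^sub>v v) $ kP"
    using Wmat_carrier[of i] v kQ by (auto simp: V_def scalar_prod_def ring_distribs sum.distrib)
  also have "\<dots> = (\<Sum>e\<in>{1..i} \<union> {Suc i..N + 1}. combo v (int e)) - v $ r"
    using i unfolding Wmat_mult_kP[OF v i] Wmat_mult_Suc_kP[OF v i kQ]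
    by (subst sum.union_disjoint) auto
  also have "{1..i} \<union> {Suc i..N + 1} = {1..N + 1}" using i by auto
  finally show ?thesis .
qed

lemma V_mult_indep:
  assumes v: "v \<in> carrier_vec (Suc r)" and i: "i \<le> N" and m: "m < Suc r" "m \<noteq> kP - 1"
  shows "(V i *\<^sub>v v) $ m = (V 0 *\<^sub>v v) $ m"
proof -
  \<comment> \<open>If \<open>kQ = 1\<close> then \<open>r = kP\<close>, and index \<open>kP\<close>
    denotes the \<eta> row, not a second accordion row.\<close>
  consider "m + 1 < kP" | "m = kP" "kQ \<ge> 2" | "m = r" "m = kP \<Longrightarrow> kQ < 2" | "kP < m" "m < r"
    using m kP_facts kQ_facts by (force simp: rr_def)
  then show ?thesis
  proof cases
    case 1
    then show ?thesis using V_mult_same[OF v m(1)] Wmat_mult_left[OF v] by simp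
  next
    case 2
    then show ?thesis using V_mult_kP[OF v] i by simp
  next
    case 3
    then show ?thesis using V_mult_same[OF v m(1)] Wmat_mult_last[OF v] by simp
  next
    case 4
    then show ?thesis using V_mult_same[OF v m(1)] Wmat_mult_right[OF v] by simp
  qed
qed

text \<open>Translates vanishing rows into the hypotheses on partial sums: rows before
  \<open>kP - 1\<close> give \<open>left\<close> and \<open>zero\<close>, row \<open>kP\<close>
  gives \<open>full\<close> if \<open>kQ \<ge> 2\<close>, the rows between \<open>kP\<close> and
  \<open>r\<close> give \<open>right\<close>, row \<open>r\<close> gives \<open>eta\<close>.\<close>

lemma kernel_vector:
  assumes v: "v \<in> carrier_vec (Suc r)" and i: "i \<le> N"
    and ker: "\<And>m. m < Suc r \<Longrightarrow> m \<noteq> kP - 1 \<Longrightarrow> (V i *\<^sub>v v) $ m = 0"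
  shows "\<And>j. 1 \<le> j \<Longrightarrow> j \<le> N \<Longrightarrow> cut (partial_sums (combo v) (v $ r)) (int j) = 0"
    and "\<And>e. 2 - int kP \<le> e \<Longrightarrow> e \<le> int N + int kQ - 1 \<Longrightarrow>
      partial_sums (combo v) (v $ r) e - partial_sums (combo v) (v $ r) (e - 1) = combo v e"
proof -
  have left: "combo v e = 0" if "2 - int kP \<le> e" "e < 0" for e
  proof -
    define m where "m = nat (e + int kP - 2)"
    have m: "m + 2 < kP" "int m + 2 - int kP = e" using that by (auto simp: m_def)
    then show ?thesis
      using ker[of m] V_mult_same[OF v, of m] Wmat_mult_left[OF v, of m] kQ_facts by (auto simp: rr_def)
  qed
  have zero: "combo v 0 + v $ r = 0" if "kP \<ge> 2"
  proof -
    have m: "kP - 2 < Suc r" "kP - 2 \<noteq> kP - 1" "kP - 2 \<noteq> kP" "kP - 2 + 1 < kP" "kP - 2 + 2 = kP"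
      "int (kP - 2) + 2 - int kP = 0"
      using that by (auto simp: rr_def)
    show ?thesis
      using ker[OF m(1,2)] V_mult_same[OF v m(1)] Wmat_mult_left[OF v m(4)] m(3,5,6) by simp
  qed
  have full: "(\<Sum>e = 1..N + 1. combo v (int e)) - v $ r = 0" if "kQ \<ge> 2"
    using that ker[of kP] V_mult_kP[OF v i that] kP_facts by (auto simp: rr_def)
  have right: "combo v e = 0" if "int N + 2 \<le> e" "e \<le> int N + int kQ - 1" for e
  proof -
    define m where "m = nat (e + int kP - 1 - int N)"
    have m: "kP < m" "m < r" "int m + int N + 1 - int kP = e" using that kP_facts by (auto simp: m_def rr_def)
    then show ?thesis
      using ker[of m] V_mult_same[OF v, of m] Wmat_mult_right[OF v, of m] by auto
  qed
  have eta: "(\<Sum>e = 1..kQ. of_real (eta_tail e) * combo v (int e)) + of_real ((\<Sum>l = 1..kP. p l) - eta_tail 1) * v $ r = 0"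
    unfolding Wmat_mult_last[OF v, of i, symmetric]
    using ker[of r] V_mult_same[OF v, of r] kP_facts kQ_facts by (auto simp: rr_def)
  show "cut (partial_sums (combo v) (v $ r)) (int j) = 0" if "1 \<le> j" "j \<le> N" for j
    by (rule partial_sums_cut[OF left zero full right eta cut_combo that])
  show "partial_sums (combo v) (v $ r) e - partial_sums (combo v) (v $ r) (e - 1) = combo v e"
    if "2 - int kP \<le> e" "e \<le> int N + int kQ - 1" for e
    by (rule partial_sums_diff[OF left zero full right that])
qed

lemma kernel_vector_invariant:
  assumes v: "v \<in> carrier_vec (Suc r)" and i: "i \<le> N"
    and ker: "\<And>m. m < Suc r \<Longrightarrow> m \<noteq> kP - 1 \<Longrightarrow> (V i *\<^sub>v v) $ m = 0"
    and \<nu>: "invariant \<nu>" "(\<Sum>i\<le>N. \<nu> i) = 1" and j: "j \<le> N"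
  shows "partial_sums (combo v) (v $ r) (int j)
    = (\<Sum>j\<le>N. partial_sums (combo v) (v $ r) (int j)) * of_real (\<nu> j)"
proof (rule invariant_complex_unique[OF cut_imp_invariant \<nu> j])
  show "partial_sums (combo v) (v $ r) e = 0" if "e < 0 \<or> e > int N" for e
    using that by (auto simp: partial_sums_def)
qed (use kernel_vector(1)[OF v i ker] in auto)

lemma V_mult_kP_minus_1:
  assumes v: "v \<in> carrier_vec (Suc r)" and i: "i \<le> N"
  shows "(V i *\<^sub>v v) $ (kP - 1) = partial_sums (combo v) (v $ r) (int i)"
  using V_mult_same[OF v, of "kP - 1" i] Wmat_mult_kP[OF v i] i kP_facts kQ_facts
  by (auto simp: partial_sums_def rr_def)

text \<open>A kernel vector yields an invariant vector vanishing at \<open>i\<close>. Being a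
  multiple of \<nu>, which is nonzero there, it is zero; then \<open>t = 0\<close>, and injectivity
  removes the remaining entries.\<close>

lemma det_W_nonzero:
  assumes \<nu>: "invariant \<nu>" "(\<Sum>i\<le>N. \<nu> i) = 1" and i: "i \<le> N" "\<nu> i \<noteq> 0"
  shows "det (W i) \<noteq> 0"
proof
  assume "det (W i) = 0"
  then have "det (V i) = 0" by (simp add: det_V)
  then obtain v where v: "v \<in> carrier_vec (Suc r)" "v \<noteq> 0\<^sub>v (Suc r)" "V i *\<^sub>v v = 0\<^sub>v (Suc r)"
    using det_0_iff_vec_prod_zero[OF V_carrier] by blast
  have ker: "(V i *\<^sub>v v) $ m = 0" if "m < Suc r" for m using v that by simp
  let ?u = "partial_sums (combo v) (v $ r)"
  note uniq = kernel_vector_invariant[OF v(1) i(1) ker \<nu>]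
  have "kP - 1 < Suc r" using kQ_facts by (simp add: rr_def)
  then have "?u (int i) = 0" using ker V_mult_kP_minus_1[OF v(1) i(1)] by simp
  then have "(\<Sum>j\<le>N. ?u (int j)) = 0" using uniq[OF _ i(1)] i(2) by simp
  then have "?u (int j) = 0" if "j \<le> N" for j using uniq[OF _ that] by simp
  then have u0: "?u e = 0" for e
    by (cases "0 \<le> e \<and> e \<le> int N") (auto simp: partial_sums_def dest!: zero_le_imp_eq_int)
  have "combo v e = 0" if "2 - int kP \<le> e" "e \<le> int kQ" for e
    using kernel_vector(2)[OF v(1) i(1) ker, of e] that u0 N_ge kP_facts by simp
  then have "v $ a = 0" if "a < r" for a using combo_injective that by blast
  moreover have "v $ r = 0" using u0[of 0] by (simp add: partial_sums_def)
  ultimately have "v = 0\<^sub>v (Suc r)" using v(1) by (intro eq_vecI) (auto simp: less_Suc_eq)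
  then show False using v by simp
qed

lemma det_W_invariant:
  assumes \<nu>: "invariant \<nu>" "(\<Sum>i\<le>N. \<nu> i) = 1" and i: "i \<le> N"
  shows "det (W i) = (\<Sum>j\<le>N. det (W j)) * of_real (\<nu> i)"
proof -
  define C where "C = vec (Suc r) (cofactor (V 0) (kP - 1))"
  have C: "C \<in> carrier_vec (Suc r)" by (simp add: C_def)
  have s: "kP - 1 < Suc r" using kQ_facts by (simp add: rr_def)
  have VC: "V j *\<^sub>v C = det (W j) \<cdot>\<^sub>v unit_vec (Suc r) (kP - 1)" if j: "j \<le> N" for j
  proof -
    have "V j $$ (m, a) = V 0 $$ (m, a)" if "m < Suc r" "a < Suc r" "m \<noteq> kP - 1" for m a
    proof -
      \<comment> \<open>Unit vectors turn the statement \<open>V_mult_indep\<close> about products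
        into one about entries.\<close>
      have "V j $$ (m, a) = (V j *\<^sub>v unit_vec (Suc r) a) $ m" for j
        using that V_carrier[of j] by simp
      then show ?thesis using V_mult_indep[OF _ j that(1,3)] by simp
    qed
    \<comment> \<open>Only row \<open>kP - 1\<close> depends on \<open>j\<close>, so one cofactor
      vector serves all \<open>j\<close>.\<close>
    then have "C = vec (Suc r) (cofactor (V j) (kP - 1))"
      unfolding C_def using V_carrier s by (intro eq_vecI) (auto intro!: cofactor_cong_row)
    then show ?thesis using mult_mat_vec_cofactors[OF V_carrier s] det_V by simp
  qed
  have det: "det (W j) = partial_sums (combo C) (C $ r) (int j)" if "j \<le> N" for j
    using V_mult_kP_minus_1[OF C that] VC[OF that] s by simp
  have "(V 0 *\<^sub>v C) $ m = 0" if "m < Suc r" "m \<noteq> kP - 1" for m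
    using VC[of 0] that s by simp
  from kernel_vector_invariant[OF C _ this \<nu> i] show ?thesis using det i by simp
qed

end

theorem mainTheorem7:
  fixes k N :: nat and p q :: "nat \<Rightarrow> real" and ys :: "complex list"
  assumes k_pos: "k \<ge> 1"
    and p_nonneg: "\<forall>j\<in>{1..k}. p j \<ge> 0"
    and q_nonneg: "\<forall>j\<in>{1..k}. q j \<ge> 0"
    and total: "(\<Sum>j = 1..k. p j + q j) = 1"
    and p_pos: "(\<Sum>j = 1..k. p j) > 0"
    and q_pos: "(\<Sum>j = 1..k. q j) > 0"
    and aperiodic: "Gcd {j\<in>{1..k}. p j + q j > 0} = (1::nat)"
    and N_ge: "N \<ge> kp k p + kq k q"
    and ys_distinct: "distinct ys"
    and ys_roots: "set ys = {y. y \<noteq> 0 \<and> poly (psi k p q) y = 0}"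
    and ys_sorted: "sorted (map cmod ys)"
  shows "(\<Sum>j\<le>N. det (Wmat k p q N ys j)) \<noteq> 0
     \<and> (\<exists>\<pi>. is_stationary k p q N \<pi>)
     \<and> (\<forall>\<pi>. is_stationary k p q N \<pi> \<longrightarrow>
            (\<forall>i\<le>N. complex_of_real (\<pi> i) =
               det (Wmat k p q N ys i) / (\<Sum>j\<le>N. det (Wmat k p q N ys j))))"
proof -
  interpret random_leap_roots k N p q ys
    by unfold_locales (fact assms)+
  have stat: "is_stationary k p q N \<pi> \<longleftrightarrow> (\<forall>i\<le>N. 0 \<le> \<pi> i) \<and> (\<Sum>i\<le>N. \<pi> i) = 1 \<and> invariant \<pi>" for \<pi>
    by (simp add: is_stationary_def invariant_def)
  obtain \<nu> where \<nu>: "is_stationary k p q N \<nu>" using stationary_exists stat by blast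
  then have inv: "invariant \<nu>" "(\<Sum>i\<le>N. \<nu> i) = 1" by (auto simp: stat)
  then obtain i where i: "i \<le> N" "\<nu> i \<noteq> 0" by (metis atMost_iff sum.neutral zero_neq_one)
  have S: "(\<Sum>j\<le>N. det (W j)) \<noteq> 0"
    using det_W_nonzero[OF inv i] det_W_invariant[OF inv i(1)] by auto
  \<comment> \<open>\<open>det_W_invariant\<close> applies to any stationary \<pi>, which gives
    uniqueness and the formula at once.\<close>
  have "of_real (\<pi> i) = det (W i) / (\<Sum>j\<le>N. det (W j))"
    if "is_stationary k p q N \<pi>" "i \<le> N" for \<pi> i
    using det_W_invariant[of \<pi> i] that S by (simp add: stat)
  then show ?thesis using S \<nu> by blast
qed

end
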